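(* The classes QI, QE and QC of ordered simplicial complexes are pairwise distinct; furthermore, none of these three classes is contained in another one of them.
   Context: An ordered simplicial complex is a pair $\Psi=(E,\Delta)$ with $E$ a finite totally ordered set and $\Delta\subseteq 2^E$ a simplicial complex (closed under taking subsets, $\emptyset\in\Delta$). Elements of $\Delta$ are independent sets; inclusion-maximal ones are bases; inclusion-minimal subsets of $E$ not in $\Delta$ are circuits. $\Psi$ is pure if all bases have the same cardinality. The lexicographic order on subsets of $E$ is the dictionary order on increasingly sorted lists. For an independent set $I$, the contraction of $I$ is the ordered complex on $E\setminus I$ with independent sets $\{J\subseteq E\setminus I: J\cup I\in\Delta\}$, and $B_{I,0}$ denotes its lexicographically smallest basis. QI: the class of $\Psi$ that are pure and such that for all independent $I_1,I_2$ with $|I_1|>|I_2|$, if $I_1\setminus I\subseteq B_{I,0}$ for some $I\subseteq I_1\cap I_2$, then there is $e\in I_1\setminus I_2$ with $I_2\cup\{e\}\in\Delta$. QE: the class of $\Psi$ that are pure and such that for all bases $B_1,B_2$ and $b_1\in B_1\setminus B_2$ with $b_1>\max(B_2\setminus B_1)$, there is $b_2\in B_2\setminus B_1$ with $(B_1\setminus\{b_1\})\cup\{b_2\}\in\Delta$. QC: the class of $\Psi$ such that if $C_1\neq C_2$ are circuits and $c\in C_1\cap C_2$ satisfies $c<\max (C_1\triangle C_2)$, then there is a circuit $C_3\subseteq (C_1\cup C_2)\setminus\{c\}$. *)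

theory Defs
  imports Main
begin

type_synonym 'a complex = "'a set \<times> 'a set set"

definition ground :: "'a complex \<Rightarrow> 'a set" where
  "ground K = fst K"

definition indeps :: "'a complex \<Rightarrow> 'a set set" where
  "indeps K = snd K"

text \<open>The total order on the ground set is the one inherited from the linearly ordered ambient type.\<close>

definition ordered_complex :: "'a::linorder complex \<Rightarrow> bool" where
  "ordered_complex K \<longleftrightarrow>
     finite (ground K) \<and> indeps K \<subseteq> Pow (ground K) \<and> {} \<in> indeps K \<and>
     (\<forall>I \<in> indeps K. \<forall>J. J \<subseteq> I \<longrightarrow> J \<in> indeps K)"

definition bases :: "'a complex \<Rightarrow> 'a set set" where
  "bases K = {B \<in> indeps K. \<not> (\<exists>I \<in> indeps K. B \<subset> I)}"

definition circuits :: "'a complex \<Rightarrow> 'a set set" where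
  "circuits K = {C. C \<subseteq> ground K \<and> C \<notin> indeps K \<and>
                    \<not> (\<exists>D. D \<subset> C \<and> D \<notin> indeps K)}"

definition pure :: "'a complex \<Rightarrow> bool" where
  "pure K \<longleftrightarrow> (\<forall>B1 \<in> bases K. \<forall>B2 \<in> bases K. card B1 = card B2)"

definition contraction :: "'a complex \<Rightarrow> 'a set \<Rightarrow> 'a complex" where
  "contraction K I = (ground K - I, {J. J \<subseteq> ground K - I \<and> J \<union> I \<in> indeps K})"

text \<open>Strict dictionary order on finite sets; a proper prefix is smaller.\<close>

definition lex_less :: "'a::linorder set \<Rightarrow> 'a set \<Rightarrow> bool" where
  "lex_less A B \<longleftrightarrow>
     (sorted_list_of_set A, sorted_list_of_set B) \<in> lexord {(x, y). x < y}"

definition lex_least_basis :: "'a::linorder complex \<Rightarrow> 'a set" where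
  "lex_least_basis K =
     (THE B. B \<in> bases K \<and> (\<forall>B' \<in> bases K. B' \<noteq> B \<longrightarrow> lex_less B B'))"

text \<open>The set written \<open>B\<^bsub>I,0\<^esub>\<close>; it is well defined whenever \<open>I\<close> is independent,
  see \<open>B0_unique\<close> below.\<close>

definition B0 :: "'a::linorder complex \<Rightarrow> 'a set \<Rightarrow> 'a set" where
  "B0 K I = lex_least_basis (contraction K I)"

definition QI :: "'a::linorder complex set" where
  "QI = {K. ordered_complex K \<and> pure K \<and>
     (\<forall>I1 \<in> indeps K. \<forall>I2 \<in> indeps K.
        card I1 > card I2 \<and> (\<exists>I. I \<subseteq> I1 \<inter> I2 \<and> I1 - I \<subseteq> B0 K I) \<longrightarrow>
        (\<exists>e \<in> I1 - I2. I2 \<union> {e} \<in> indeps K))}"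

text \<open>\<open>Max\<close> is only applied to nonempty finite sets below: \<open>B2 - B1\<close> is nonempty in \<open>QE\<close>
  because \<open>B1\<close> and \<open>B2\<close> have the same size and \<open>b1 \<in> B1 - B2\<close>, and the symmetric
  difference in \<open>QC\<close> is nonempty because \<open>C1 \<noteq> C2\<close>. Purity is not required in \<open>QC\<close>.\<close>

definition QE :: "'a::linorder complex set" where
  "QE = {K. ordered_complex K \<and> pure K \<and>
     (\<forall>B1 \<in> bases K. \<forall>B2 \<in> bases K. \<forall>b1 \<in> B1 - B2.
        b1 > Max (B2 - B1) \<longrightarrow>
        (\<exists>b2 \<in> B2 - B1. (B1 - {b1}) \<union> {b2} \<in> indeps K))}"

definition QC :: "'a::linorder complex set" where
  "QC = {K. ordered_complex K \<and>
     (\<forall>C1 \<in> circuits K. \<forall>C2 \<in> circuits K. \<forall>c \<in> C1 \<inter> C2.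
        C1 \<noteq> C2 \<and> c < Max ((C1 - C2) \<union> (C2 - C1)) \<longrightarrow>
        (\<exists>C3 \<in> circuits K. C3 \<subseteq> (C1 \<union> C2) - {c}))}"

lemma ordered_complex_contraction:
  assumes "ordered_complex K" "I \<in> indeps K"
  shows "ordered_complex (contraction K I)"
proof -
  have K: "finite (ground K)"
    and down: "\<And>I J. I \<in> indeps K \<Longrightarrow> J \<subseteq> I \<Longrightarrow> J \<in> indeps K"
    using assms(1) by (simp_all add: ordered_complex_def)
  have g: "ground (contraction K I) = ground K - I"
    and i: "indeps (contraction K I) = {J. J \<subseteq> ground K - I \<and> J \<union> I \<in> indeps K}"
    by (simp_all add: contraction_def ground_def indeps_def)
  show ?thesis
    unfolding ordered_complex_def g i
  proof (intro conjI ballI allI impI)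
    fix J J' assume J: "J \<in> {J. J \<subseteq> ground K - I \<and> J \<union> I \<in> indeps K}" and J': "J' \<subseteq> J"
    have "J' \<union> I \<in> indeps K"
      by (rule down[of "J \<union> I"]) (use J J' in \<open>simp_all add: le_supI1\<close>)
    moreover have "J' \<subseteq> ground K - I" using J J' by (simp add: subset_trans)
    ultimately show "J' \<in> {J. J \<subseteq> ground K - I \<and> J \<union> I \<in> indeps K}" by simp
  qed (use K assms(2) in simp_all, simp add: subset_iff)
qed

lemma lex_least_basis_unique:
  fixes K :: "'a::linorder complex"
  assumes K: "ordered_complex K"
  shows "\<exists>!B. B \<in> bases K \<and> (\<forall>B' \<in> bases K. B' \<noteq> B \<longrightarrow> lex_less B B')"
proof -
  let ?r = "{(x, y). x < (y::'a)}"
  have finE: "finite (ground K)" and sub: "indeps K \<subseteq> Pow (ground K)"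
    and ne: "{} \<in> indeps K" using K by (auto simp: ordered_complex_def)
  have finD: "finite (indeps K)" using finE sub by (meson finite_Pow_iff finite_subset)
  have bsub: "bases K \<subseteq> indeps K" by (auto simp: bases_def)
  have finB: "finite (bases K)" using bsub finD finite_subset by blast
  have fin: "finite B" if "B \<in> bases K" for B
    using that bsub sub finE by (meson PowD finite_subset subsetD)
  have "indeps K \<noteq> {}" using ne by blast
  from finite_has_maximal[OF finD this]
  obtain M where M: "M \<in> indeps K" "\<forall>I \<in> indeps K. M \<subseteq> I \<longrightarrow> M = I" by blast
  have "M \<in> bases K" using M by (auto simp: bases_def)
  then have nonempty: "bases K \<noteq> {}" by blast
  have trans: "lex_less A C" if "lex_less A B" "lex_less B C" for A B C :: "'a set"
    using that unfolding lex_less_def by (rule lexord_trans) (auto intro!: transI)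
  have irr: "\<not> lex_less A A" for A :: "'a set"
    unfolding lex_less_def by (rule lexord_irreflexive) simp
  have total: "lex_less A B \<or> A = B \<or> lex_less B A" if "A \<in> bases K" "B \<in> bases K" for A B
  proof -
    have "set (sorted_list_of_set A) = A" "set (sorted_list_of_set B) = B"
      using fin that by simp_all
    then have "sorted_list_of_set A = sorted_list_of_set B \<longrightarrow> A = B" by metis
    moreover have "\<forall>a b. (a, b) \<in> ?r \<or> a = b \<or> (b, a) \<in> ?r" by auto
    ultimately show ?thesis unfolding lex_less_def
      using lexord_linear[of ?r "sorted_list_of_set A" "sorted_list_of_set B"] by argo
  qed
  have "\<exists>B \<in> S. \<forall>B' \<in> S. B' \<noteq> B \<longrightarrow> lex_less B B'"
    if "finite S" "S \<noteq> {}" "S \<subseteq> bases K" for S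
    using that
  proof (induction S rule: finite_ne_induct)
    case (insert x F)
    then obtain B where B: "B \<in> F" "\<forall>B' \<in> F. B' \<noteq> B \<longrightarrow> lex_less B B'" by auto
    have "lex_less B x \<or> lex_less x B" using total[of B x] B insert by blast
    then show ?case
    proof
      assume "lex_less B x"
      then have "\<forall>B' \<in> insert x F. B' \<noteq> B \<longrightarrow> lex_less B B'" using B by simp
      then show ?case using B(1) by blast
    next
      assume x: "lex_less x B"
      have "lex_less x B'" if "B' \<in> F" for B'
        using B(2) that x trans[OF x, of B'] by (cases "B' = B") simp_all
      then have "\<forall>B' \<in> insert x F. B' \<noteq> x \<longrightarrow> lex_less x B'" by simp
      then show ?case by blast
    qed
  qed simp
  from this[OF finB nonempty] obtain B where
    B: "B \<in> bases K" "\<forall>B' \<in> bases K. B' \<noteq> B \<longrightarrow> lex_less B B'" by blast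
  show ?thesis
  proof (rule ex1I[of _ B])
    fix A assume A: "A \<in> bases K \<and> (\<forall>B' \<in> bases K. B' \<noteq> A \<longrightarrow> lex_less A B')"
    show "A = B"
    proof (rule ccontr)
      assume "A \<noteq> B"
      then have "lex_less A B" "lex_less B A" using A B by auto
      from trans[OF this] irr show False by blast
    qed
  qed (use B in blast)
qed

lemma B0_unique:
  assumes "ordered_complex K" "I \<in> indeps K"
  shows "\<exists>!B. B \<in> bases (contraction K I) \<and>
              (\<forall>B' \<in> bases (contraction K I). B' \<noteq> B \<longrightarrow> lex_less B B')"
  by (rule lex_least_basis_unique[OF ordered_complex_contraction[OF assms]])

end

theory Submission
  imports Defs
begin

text \<open>
  Rank-two complexes on four vertices, that is, ordered graphs without isolated vertices, already
  separate the three classes. For such a graph, QI says that every vertex outside the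
  lexicographically least edge is adjacent to one of its endpoints. The triangle \<open>123\<close> with the
  pendant edge \<open>03\<close> lies only in QI, the path \<open>0-2-1-3\<close> only in QE, and the triangle \<open>012\<close> with
  the pendant edge \<open>23\<close> only in QC.
\<close>

section \<open>Rank-two complexes built from graphs\<close>

definition graph_complex :: "'a set \<Rightarrow> 'a set set \<Rightarrow> 'a complex" where
  "graph_complex V F = (V, {I. I \<subseteq> V \<and> card I \<le> 1} \<union> F)"

text \<open>Covering \<open>V\<close> by edges rules out isolated vertices, which is what makes the
  complex pure. Finiteness of \<open>V\<close> matters for \<open>card I \<le> 1\<close> in
  \<open>graph_complex\<close>, since an infinite set has \<open>card\<close> 0.\<close>

definition graph_on :: "'a set \<Rightarrow> 'a set set \<Rightarrow> bool" where
  "graph_on V F \<longleftrightarrow> finite V \<and> (\<forall>e\<in>F. card e = 2) \<and> \<Union>F = V"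

lemma ground_graph_complex [simp]: "ground (graph_complex V F) = V"
  by (simp add: ground_def graph_complex_def)

lemma mem_indeps_graph_complex:
  "I \<in> indeps (graph_complex V F) \<longleftrightarrow> I \<subseteq> V \<and> card I \<le> 1 \<or> I \<in> F"
  by (simp add: indeps_def graph_complex_def)

lemma doubleton_indep_iff:
  assumes "x \<noteq> y"
  shows "{x, y} \<in> indeps (graph_complex V F) \<longleftrightarrow> {x, y} \<in> F"
  using assms by (simp add: mem_indeps_graph_complex)

lemma card_edge:
  assumes "graph_on V F" "e \<in> F"
  shows "card e = 2"
  using assms by (simp add: graph_on_def)

lemma finite_edge:
  assumes "graph_on V F" "e \<in> F"
  shows "finite e"
  using card_edge[OF assms] by (simp add: card_ge_0_finite)

lemma indep_subset:
  assumes "graph_on V F" "I \<in> indeps (graph_complex V F)"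
  shows "I \<subseteq> V"
  using assms by (auto simp: graph_on_def mem_indeps_graph_complex)

lemma finite_indep:
  assumes "graph_on V F" "I \<in> indeps (graph_complex V F)"
  shows "finite I"
  using indep_subset[OF assms] assms(1) by (auto simp: graph_on_def intro: finite_subset)

lemma card_indep_le:
  assumes "graph_on V F" "I \<in> indeps (graph_complex V F)"
  shows "card I \<le> 2"
  using assms by (auto simp: graph_on_def mem_indeps_graph_complex)

lemma ordered_complex_graph_complex:
  fixes V :: "'a::linorder set"
  assumes F: "graph_on V F"
  shows "ordered_complex (graph_complex V F)"
  unfolding ordered_complex_def
proof (intro conjI ballI allI impI)
  fix I J
  assume I: "I \<in> indeps (graph_complex V F)" and J: "J \<subseteq> I"
  have V: "I \<subseteq> V" "card I \<le> 2" and fin: "finite I"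
    using indep_subset[OF F I] card_indep_le[OF F I] finite_indep[OF F I] by auto
  have "card J < card I" if "J \<noteq> I"
    using J that fin by (intro psubset_card_mono) auto
  then show "J \<in> indeps (graph_complex V F)"
    using I J V by (cases "J = I") (auto simp: mem_indeps_graph_complex)
next
  show "finite (ground (graph_complex V F))" using F by (simp add: graph_on_def)
  show "indeps (graph_complex V F) \<subseteq> Pow (ground (graph_complex V F))"
    using indep_subset[OF F] by auto
qed (simp add: mem_indeps_graph_complex)

text \<open>A set with at most one element sits strictly inside some edge because there are no
  isolated vertices, and an edge is maximal because independent sets have at most two elements. For
  empty \<open>V\<close> the only basis would be the empty set, which is not an edge.\<close>

lemma bases_graph_complex:
  assumes F: "graph_on V F" and "V \<noteq> {}"
  shows "bases (graph_complex V F) = F"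
proof (intro set_eqI iffI)
  fix B
  assume B: "B \<in> bases (graph_complex V F)"
  have covered: "\<exists>e\<in>F. {x} \<subset> e" if "x \<in> V" for x
  proof -
    obtain e where e: "e \<in> F" "x \<in> e" using \<open>x \<in> V\<close> F by (auto simp: graph_on_def)
    moreover have "e \<noteq> {x}" using e F by (auto simp: graph_on_def)
    ultimately show ?thesis by blast
  qed
  show "B \<in> F"
  proof (rule ccontr)
    assume "B \<notin> F"
    then have "B \<in> indeps (graph_complex V F)" "card B \<le> 1"
      using B by (auto simp: bases_def mem_indeps_graph_complex)
    then have "B \<subseteq> V" "finite B" "card B = 0 \<or> card B = 1"
      using indep_subset[OF F, of B] finite_indep[OF F, of B] by linarith+
    \<comment> \<open>For empty \<open>B\<close> any vertex serves as \<open>x\<close>; this is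
      where \<open>V \<noteq> {}\<close> enters.\<close>
    then obtain x where "x \<in> V" "B \<subseteq> {x}"
      using \<open>V \<noteq> {}\<close> by (auto simp: card_1_singleton_iff)
    moreover obtain e where "e \<in> F" "{x} \<subset> e" using covered[OF \<open>x \<in> V\<close>] by blast
    ultimately have "B \<subset> e" "e \<in> indeps (graph_complex V F)"
      by (auto simp: mem_indeps_graph_complex)
    then show False using B by (auto simp: bases_def)
  qed
next
  fix B
  assume B: "B \<in> F"
  have "\<not> B \<subset> I" if "I \<in> indeps (graph_complex V F)" for I
  proof
    assume "B \<subset> I"
    then have "card B < card I" using finite_indep[OF F that] by (simp add: psubset_card_mono)
    then show False using card_indep_le[OF F that] card_edge[OF F B] by simp
  qed
  then show "B \<in> bases (graph_complex V F)"
    using B by (auto simp: bases_def mem_indeps_graph_complex)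
qed

lemma pure_graph_complex:
  assumes "graph_on V F" "V \<noteq> {}"
  shows "pure (graph_complex V F)"
  using assms(1) by (simp add: pure_def bases_graph_complex[OF assms] graph_on_def)

lemma indeps_downward_closed:
  assumes "ordered_complex K" "I \<in> indeps K" "J \<subseteq> I"
  shows "J \<in> indeps K"
  using assms unfolding ordered_complex_def by blast

section \<open>The class QI for graphs\<close>

lemma contraction_empty:
  assumes "ordered_complex K"
  shows "contraction K {} = K"
  using assms by (cases K) (auto simp: contraction_def ordered_complex_def ground_def indeps_def)

lemma lex_least_basis_eqI:
  assumes "ordered_complex K" "B \<in> bases K" "\<And>B'. B' \<in> bases K \<Longrightarrow> B' \<noteq> B \<Longrightarrow> lex_less B B'"
  shows "lex_least_basis K = B"
  unfolding lex_least_basis_def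
  by (rule the1_equality[OF lex_least_basis_unique]) (use assms in auto)

text \<open>The contraction at the empty set is the only one whose least basis has to be computed:
  in rank two, the instances of QI with nonempty \<open>I\<close> hold for every graph.\<close>

lemma B0_graph_complex_empty:
  fixes V :: "'a::linorder set"
  assumes F: "graph_on V F" and e: "e \<in> F" "\<And>e'. e' \<in> F \<Longrightarrow> e' \<noteq> e \<Longrightarrow> lex_less e e'"
  shows "B0 (graph_complex V F) {} = e"
proof -
  have "V \<noteq> {}" using F e(1) by (fastforce simp: graph_on_def)
  have "lex_least_basis (graph_complex V F) = e"
    by (rule lex_least_basis_eqI[OF ordered_complex_graph_complex[OF F]])
      (use e in \<open>simp_all add: bases_graph_complex[OF F \<open>V \<noteq> {}\<close>]\<close>)
  then show ?thesis
    by (simp add: B0_def contraction_empty[OF ordered_complex_graph_complex[OF F]])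
qed

text \<open>Augmenting the empty set is trivial, so only \<open>I2 = {x}\<close> with an edge
  \<open>I1\<close> remains. If \<open>x\<close> lies on \<open>I1\<close>, the other endpoint
  works. Otherwise \<open>I\<close> is empty, which forces \<open>I1\<close> to be the least edge
  \<open>e\<close>, and augmentation says that \<open>x\<close> has a neighbour in
  \<open>e\<close>.\<close>

lemma graph_complex_in_QI_iff:
  fixes V :: "'a::linorder set"
  assumes F: "graph_on V F" and e: "e \<in> F" "\<And>e'. e' \<in> F \<Longrightarrow> e' \<noteq> e \<Longrightarrow> lex_less e e'"
  shows "graph_complex V F \<in> QI \<longleftrightarrow> (\<forall>x\<in>V - e. \<exists>y\<in>e. {x, y} \<in> F)"
proof
  have B0: "B0 (graph_complex V F) {} = e" by (rule B0_graph_complex_empty[OF assms])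
  have card_e: "card e = 2" using F e(1) by (auto simp: graph_on_def)
  {
    assume QI: "graph_complex V F \<in> QI"
    show "\<forall>x\<in>V - e. \<exists>y\<in>e. {x, y} \<in> F"
    proof
      fix x
      assume x: "x \<in> V - e"
      \<comment> \<open>Instance of QI with \<open>I1 = e\<close>, \<open>I2 = {x}\<close> and
        \<open>I = {}\<close>.\<close>
      have "e \<in> indeps (graph_complex V F)" "{x} \<in> indeps (graph_complex V F)"
        using e(1) x by (auto simp: mem_indeps_graph_complex)
      moreover have "card {x} < card e" using card_e by simp
      moreover have "{} \<subseteq> e \<inter> {x} \<and> e - {} \<subseteq> B0 (graph_complex V F) {}" by (simp add: B0)
      ultimately obtain y where y: "y \<in> e - {x}" "{x} \<union> {y} \<in> indeps (graph_complex V F)"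
        using QI unfolding QI_def mem_Collect_eq by meson
      then have "{x, y} \<in> F" using doubleton_indep_iff[of x y V F] by (auto simp only: insert_is_Un[of x "{y}"])
      then show "\<exists>y\<in>e. {x, y} \<in> F" using y(1) by blast
    qed
  }
  assume adj: "\<forall>x\<in>V - e. \<exists>y\<in>e. {x, y} \<in> F"
  have "V \<noteq> {}" using F e(1) card_e by (fastforce simp: graph_on_def)
  have "\<exists>y\<in>I1 - I2. I2 \<union> {y} \<in> indeps (graph_complex V F)"
    if I1: "I1 \<in> indeps (graph_complex V F)" and I2: "I2 \<in> indeps (graph_complex V F)"
      and less: "card I2 < card I1"
      and I: "I \<subseteq> I1 \<inter> I2" "I1 - I \<subseteq> B0 (graph_complex V F) I" for I1 I2 I
  proof (cases "I2 = {}")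
    case True
    obtain y where "y \<in> I1" using less by fastforce
    moreover have "y \<in> V" using indep_subset[OF F I1] \<open>y \<in> I1\<close> by blast
    ultimately show ?thesis using True by (auto simp: mem_indeps_graph_complex)
  next
    case False
    have "card I2 \<noteq> 0" using False finite_indep[OF F I2] by simp
    then have "card I2 = 1" "card I1 = 2" using card_indep_le[OF F I1] less by auto
    then have "I1 \<in> F" using I1 by (simp add: mem_indeps_graph_complex)
    obtain x where x: "I2 = {x}" using \<open>card I2 = 1\<close> by (auto simp: card_1_singleton_iff)
    have "x \<in> V" using indep_subset[OF F I2] x by simp
    show ?thesis
    proof (cases "x \<in> I1")
      case True
      obtain y where "I1 = {x, y}" "x \<noteq> y"
        using True \<open>card I1 = 2\<close> by (auto simp: card_2_iff)
      then show ?thesis using \<open>I1 \<in> F\<close> x by (auto simp: mem_indeps_graph_complex insert_commute)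
    next
      case False
      then have "I = {}" using I(1) x by blast
      then have "I1 \<subseteq> e" using I(2) B0 by simp
      then have "I1 = e"
        using card_e \<open>card I1 = 2\<close> finite_edge[OF F e(1)] by (metis card_subset_eq)
      then obtain y where "y \<in> e" "{x, y} \<in> F" using adj False \<open>x \<in> V\<close> by blast
      then show ?thesis using x False \<open>I1 = e\<close>
        by (intro bexI[of _ y]) (auto simp: mem_indeps_graph_complex insert_commute)
    qed
  qed
  then show "graph_complex V F \<in> QI"
    using ordered_complex_graph_complex[OF F] pure_graph_complex[OF F \<open>V \<noteq> {}\<close>]
    unfolding QI_def by blast
qed

lemma graph_complex_notin_QI:
  fixes V :: "'a::linorder set"
  assumes F: "graph_on V F" and e: "e \<in> F" "\<And>e'. e' \<in> F \<Longrightarrow> e' \<noteq> e \<Longrightarrow> lex_less e e'"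
    and x: "x \<in> V" "x \<notin> e" "\<And>y. y \<in> e \<Longrightarrow> {x, y} \<notin> F"
  shows "graph_complex V F \<notin> QI"
  using x by (auto simp: graph_complex_in_QI_iff[OF F e])

section \<open>The class QE for graphs\<close>

text \<open>The exchanged set still has two elements, so it is independent only if it is an edge.
  This reduces QE to a finite check on edges.\<close>

lemma graph_complex_in_QE_iff:
  fixes V :: "'a::linorder set"
  assumes F: "graph_on V F" and "V \<noteq> {}"
  shows "graph_complex V F \<in> QE \<longleftrightarrow>
    (\<forall>B1\<in>F. \<forall>B2\<in>F. \<forall>b1\<in>B1 - B2. b1 > Max (B2 - B1) \<longrightarrow> (\<exists>b2\<in>B2 - B1. (B1 - {b1}) \<union> {b2} \<in> F))"
proof -
  have "(B1 - {b1}) \<union> {b2} \<in> indeps (graph_complex V F) \<longleftrightarrow> (B1 - {b1}) \<union> {b2} \<in> F"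
    if "B1 \<in> F" "b1 \<in> B1" "b2 \<notin> B1" for B1 b1 b2
  proof -
    obtain a where "B1 = {b1, a}" "b1 \<noteq> a"
      using card_edge[OF F \<open>B1 \<in> F\<close>] \<open>b1 \<in> B1\<close> by (auto simp: card_2_iff)
    then show ?thesis
      using that doubleton_indep_iff[of b2 a V F] by (auto simp: insert_Diff_if)
  qed
  then have "(\<forall>B1\<in>F. \<forall>B2\<in>F. \<forall>b1\<in>B1 - B2. b1 > Max (B2 - B1) \<longrightarrow>
        (\<exists>b2\<in>B2 - B1. (B1 - {b1}) \<union> {b2} \<in> indeps (graph_complex V F))) \<longleftrightarrow>
    (\<forall>B1\<in>F. \<forall>B2\<in>F. \<forall>b1\<in>B1 - B2. b1 > Max (B2 - B1) \<longrightarrow> (\<exists>b2\<in>B2 - B1. (B1 - {b1}) \<union> {b2} \<in> F))"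
    by (intro ball_cong bex_cong imp_cong refl) blast
  then show ?thesis
    by (simp only: QE_def mem_Collect_eq bases_graph_complex[OF assms]
        ordered_complex_graph_complex[OF F] pure_graph_complex[OF assms] simp_thms)
qed

text \<open>Take \<open>B1 = {a, b}\<close>, \<open>B2 = {x, y}\<close> and \<open>b1 = b\<close>.
  The two edges are disjoint and \<open>b\<close> exceeds both \<open>x\<close> and
  \<open>y\<close>, but the vertex \<open>a\<close> left after deleting \<open>b\<close> is adjacent
  to neither of them.\<close>

lemma graph_complex_notin_QE:
  fixes V :: "'a::linorder set"
  assumes F: "graph_on V F" and ab: "{a, b} \<in> F" "a \<notin> {x, y}"
    and xy: "{x, y} \<in> F" "x < b" "y < b" and nonedges: "{a, x} \<notin> F" "{a, y} \<notin> F"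
  shows "graph_complex V F \<notin> QE"
proof
  assume QE: "graph_complex V F \<in> QE"
  have "V \<noteq> {}" using F ab(1) by (auto simp: graph_on_def)
  have "a \<noteq> b" using card_edge[OF F ab(1)] by auto
  then have diff: "{x, y} - {a, b} = {x, y}" "{a, b} - {b} = {a}" "b \<in> {a, b} - {x, y}"
    using ab(2) xy(2,3) by auto
  have "Max ({x, y} - {a, b}) < b" unfolding diff(1) using xy(2,3) by simp
  then have "\<exists>z\<in>{x, y} - {a, b}. ({a, b} - {b}) \<union> {z} \<in> F"
    using graph_complex_in_QE_iff[OF F \<open>V \<noteq> {}\<close>, THEN iffD1, OF QE, rule_format, OF ab(1) xy(1) diff(3)]
    by blast
  then show False unfolding diff using nonedges by (auto simp: insert_commute)
qed

section \<open>Circuits and the class QC for graphs\<close>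

lemma nonedge_circuit:
  assumes "graph_on V F" "{x, y} \<notin> F" "x \<noteq> y" "x \<in> V" "y \<in> V"
  shows "{x, y} \<in> circuits (graph_complex V F)"
proof -
  have "D \<in> indeps (graph_complex V F)" if "D \<subset> {x, y}" for D
  proof -
    have "card D < card {x, y}" using that by (intro psubset_card_mono) auto
    then show ?thesis using that assms by (auto simp: mem_indeps_graph_complex)
  qed
  then show ?thesis using assms by (auto simp: circuits_def doubleton_indep_iff)
qed

lemma circuit_eqI:
  assumes "C \<in> circuits K" "D \<subseteq> C" "D \<notin> indeps K"
  shows "C = D"
  using assms by (auto simp: circuits_def)

text \<open>The nonedges \<open>{c, x}\<close> and \<open>{c, y}\<close> are circuits through
  \<open>c\<close>. Eliminating \<open>c\<close> would leave a circuit inside \<open>{x, y}\<close>,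
  but this is an edge, hence independent.\<close>

lemma graph_complex_notin_QC:
  fixes V :: "'a::linorder set"
  assumes F: "graph_on V F" and c: "c \<in> V" "{c, x} \<notin> F" "{c, y} \<notin> F"
    and xy: "{x, y} \<in> F" "c \<noteq> x" "c < y"
  shows "graph_complex V F \<notin> QC"
proof
  assume QC: "graph_complex V F \<in> QC"
  have V: "x \<in> V" "y \<in> V" "x \<noteq> y" using F xy(1) by (auto simp: graph_on_def)
  have "{c, x} \<in> circuits (graph_complex V F)" "{c, y} \<in> circuits (graph_complex V F)"
    using V c xy by (auto intro!: nonedge_circuit[OF F])
  moreover have "({c, x} - {c, y}) \<union> ({c, y} - {c, x}) = {x, y}" "{c, x} \<noteq> {c, y}"
    using xy \<open>x \<noteq> y\<close> by auto
  moreover have "c < Max {x, y}" using xy(3) by (simp add: less_max_iff_disj)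
  moreover have "c \<in> {c, x} \<inter> {c, y}" by simp
  moreover have "\<forall>C1\<in>circuits (graph_complex V F). \<forall>C2\<in>circuits (graph_complex V F). \<forall>c\<in>C1 \<inter> C2.
      C1 \<noteq> C2 \<and> c < Max ((C1 - C2) \<union> (C2 - C1)) \<longrightarrow>
      (\<exists>C3\<in>circuits (graph_complex V F). C3 \<subseteq> (C1 \<union> C2) - {c})"
    using QC unfolding QC_def mem_Collect_eq by (rule conjunct2)
  ultimately obtain C where C: "C \<in> circuits (graph_complex V F)" "C \<subseteq> ({c, x} \<union> {c, y}) - {c}"
    by metis
  have "C \<subseteq> {x, y}" using C(2) by blast
  moreover have "{x, y} \<in> indeps (graph_complex V F)"
    using xy(1) by (simp add: mem_indeps_graph_complex)
  ultimately have "C \<in> indeps (graph_complex V F)"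
    by (rule indeps_downward_closed[OF ordered_complex_graph_complex[OF F], rotated])
  then show False using C(1) by (simp add: circuits_def)
qed

section \<open>The three witnesses\<close>

text \<open>Lets the simplifier verify which edge of a concrete graph is lexicographically
  least.\<close>

lemma lex_less_doubleton:
  fixes a b c d :: "'a::linorder"
  assumes "a < b" "c < d"
  shows "lex_less {a, b} {c, d} \<longleftrightarrow> a < c \<or> a = c \<and> b < d"
proof -
  have "sorted_list_of_set {x, y} = [x, y]" if "x < y" for x y :: 'a
    using that by (subst sorted_list_of_set_insert_remove) auto
  then show ?thesis using assms by (auto simp: lex_less_def)
qed

text \<open>The least edge is \<open>{0, 3}\<close>, and 3 is adjacent to all other vertices. Since
  3 is the only neighbour of 0, the edge \<open>{1, 2}\<close> yields both obstructions: to
  exchanging 3 in \<open>{0, 3}\<close>, and to eliminating 0 from \<open>{0, 1}\<close> and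
  \<open>{0, 2}\<close>.\<close>

lemma QI_only_witness:
  "graph_complex {0, 1, 2, 3 :: nat} {{0, 3}, {1, 2}, {1, 3}, {2, 3}} \<in> QI - QE - QC"
  (is "graph_complex ?V ?F \<in> _")
proof -
  have F: "graph_on ?V ?F" by (auto simp: graph_on_def)
  have "graph_complex ?V ?F \<in> QI"
    by (subst graph_complex_in_QI_iff[OF F, of "{0, 3}"]) (auto simp: lex_less_doubleton)
  moreover have "graph_complex ?V ?F \<notin> QE"
    by (rule graph_complex_notin_QE[OF F, of 0 3 1 2]) (auto simp: doubleton_eq_iff)
  moreover have "graph_complex ?V ?F \<notin> QC"
    by (rule graph_complex_notin_QC[OF F, of 0 1 2]) (auto simp: doubleton_eq_iff)
  ultimately show ?thesis by blast
qed

text \<open>Exchange between edges sharing a vertex just produces \<open>B2\<close>. The only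
  disjoint edges are \<open>{0, 2}\<close> and \<open>{1, 3}\<close>; the order permits removing
  only 3, and 2 can replace it. QI fails because 3 has no neighbour in the least edge
  \<open>{0, 2}\<close>.\<close>

lemma QE_only_witness:
  "graph_complex {0, 1, 2, 3 :: nat} {{0, 2}, {1, 2}, {1, 3}} \<in> QE - QI - QC"
  (is "graph_complex ?V ?F \<in> _")
proof -
  have F: "graph_on ?V ?F" by (auto simp: graph_on_def)
  have "graph_complex ?V ?F \<in> QE"
    by (subst graph_complex_in_QE_iff[OF F]) (auto simp: insert_Diff_if doubleton_eq_iff)
  moreover have "graph_complex ?V ?F \<notin> QI"
    by (rule graph_complex_notin_QI[OF F, of "{0, 2}" 3]) (auto simp: lex_less_doubleton doubleton_eq_iff)
  moreover have "graph_complex ?V ?F \<notin> QC"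
    by (rule graph_complex_notin_QC[OF F, of 0 1 3]) (auto simp: doubleton_eq_iff)
  ultimately show ?thesis by blast
qed

text \<open>The circuits are \<open>{0, 3}\<close>, \<open>{1, 3}\<close> and
  \<open>{0, 1, 2}\<close>. Without the order condition elimination would fail for the first two,
  whose only common element is 3; but 3 is the largest vertex and so never qualifies as
  \<open>c\<close>. QI and QE fail because 3 is adjacent only to 2.\<close>

lemma QC_only_witness:
  "graph_complex {0, 1, 2, 3 :: nat} {{0, 1}, {0, 2}, {1, 2}, {2, 3}} \<in> QC - QI - QE"
  (is "graph_complex ?V ?F \<in> _")
proof -
  let ?K = "graph_complex ?V ?F"
  have F: "graph_on ?V ?F" by (auto simp: graph_on_def)
  have dep: "{0, 3} \<notin> indeps ?K" "{1, 3} \<notin> indeps ?K" "{0, 1, 2} \<notin> indeps ?K"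
    using card_indep_le[OF F, of "{0, 1, 2}"] by (auto simp: doubleton_indep_iff doubleton_eq_iff)
  have circ: "{0, 3} \<in> circuits ?K" "{1, 3} \<in> circuits ?K"
    by (rule nonedge_circuit[OF F]; simp add: doubleton_eq_iff)+
  have circ_cases: "C = {0, 3} \<or> C = {1, 3} \<or> C = {0, 1, 2}" if C: "C \<in> circuits ?K" for C
  proof (rule ccontr)
    assume "\<not> ?thesis"
    then have "\<not> {0, 3} \<subseteq> C" "\<not> {1, 3} \<subseteq> C" "\<not> {0, 1, 2} \<subseteq> C"
      using circuit_eqI[OF C _ dep(1)] circuit_eqI[OF C _ dep(2)] circuit_eqI[OF C _ dep(3)] by blast+
    moreover have "C \<subseteq> ?V" using C by (simp add: circuits_def)
    \<comment> \<open>A vertex set containing none of the three dependent sets lies inside an edge,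
      so no further circuit exists.\<close>
    ultimately have "C \<subseteq> {0, 1} \<or> C \<subseteq> {0, 2} \<or> C \<subseteq> {1, 2} \<or> C \<subseteq> {2, 3}" by blast
    then have "\<exists>I\<in>?F. C \<subseteq> I" by simp
    then obtain I where "I \<in> ?F" "C \<subseteq> I" by (rule bexE)
    then have "I \<in> indeps ?K" unfolding mem_indeps_graph_complex by blast
    then have "C \<in> indeps ?K"
      using \<open>C \<subseteq> I\<close> by (rule indeps_downward_closed[OF ordered_complex_graph_complex[OF F]])
    then show False using C by (simp add: circuits_def)
  qed
  have "?K \<in> QC"
    unfolding QC_def mem_Collect_eq
  proof (intro conjI ballI impI)
    show "ordered_complex ?K" by (rule ordered_complex_graph_complex[OF F])
  next
    fix C1 C2 c
    assume C: "C1 \<in> circuits ?K" "C2 \<in> circuits ?K" and "c \<in> C1 \<inter> C2"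
      and "C1 \<noteq> C2 \<and> c < Max ((C1 - C2) \<union> (C2 - C1))"
    then have "C1 \<noteq> C2" and c: "c < Max ((C1 - C2) \<union> (C2 - C1))" by simp_all
    have "c \<noteq> 3"
    proof
      assume "c = 3"
      have "C1 \<union> C2 \<subseteq> ?V" using C by (simp add: circuits_def)
      then have sub: "(C1 - C2) \<union> (C2 - C1) \<subseteq> ?V" by blast
      \<comment> \<open>\<open>Max\<close> is known to be an element only for a finite nonempty set;
        nonemptiness comes from \<open>C1 \<noteq> C2\<close>.\<close>
      then have "finite ((C1 - C2) \<union> (C2 - C1))" by (rule finite_subset) simp
      then have "Max ((C1 - C2) \<union> (C2 - C1)) \<in> (C1 - C2) \<union> (C2 - C1)"
        by (rule Max_in) (use \<open>C1 \<noteq> C2\<close> in blast)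
      then have "Max ((C1 - C2) \<union> (C2 - C1)) \<in> ?V" by (rule subsetD[OF sub])
      then show False using c \<open>c = 3\<close> by auto
    qed
    note cases = C[THEN circ_cases]
    then have "C1 = {0, 1, 2} \<or> 3 \<in> C1" "C2 = {0, 1, 2} \<or> 3 \<in> C2" by auto
    \<comment> \<open>Only one circuit avoids 3, so two distinct ones cannot both do so.\<close>
    then have "3 \<in> C1 \<union> C2" using \<open>C1 \<noteq> C2\<close> by blast
    moreover have "C1 = {0, 1, 2} \<or> C2 = {0, 1, 2}"
    proof (rule ccontr)
      assume "\<not> ?thesis"
      then have "C1 = {0, 3} \<and> C2 = {1, 3} \<or> C1 = {1, 3} \<and> C2 = {0, 3}"
        using cases \<open>C1 \<noteq> C2\<close> by metis
      then show False using \<open>c \<in> C1 \<inter> C2\<close> \<open>c \<noteq> 3\<close> by auto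
    qed
    then have "{0, 1} \<subseteq> C1 \<union> C2" by auto
    \<comment> \<open>The union contains 0, 1 and 3. As \<open>c\<close> is not 3, deleting it
      removes at most one of 0 and 1, and the other still forms a circuit with 3.\<close>
    ultimately have "{1, 3} \<subseteq> (C1 \<union> C2) - {c} \<or> {0, 3} \<subseteq> (C1 \<union> C2) - {c}"
      using \<open>c \<noteq> 3\<close> by auto
    then show "\<exists>C3\<in>circuits ?K. C3 \<subseteq> (C1 \<union> C2) - {c}" using circ by blast
  qed
  moreover have "?K \<notin> QI"
    by (rule graph_complex_notin_QI[OF F, of "{0, 1}" 3]) (auto simp: lex_less_doubleton doubleton_eq_iff)
  moreover have "?K \<notin> QE"
    by (rule graph_complex_notin_QE[OF F, of 3 2 0 1]) (auto simp: doubleton_eq_iff)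
  ultimately show ?thesis by blast
qed

theorem theorem4p3:
  shows "((QI :: nat complex set) \<noteq> QE \<and> (QI :: nat complex set) \<noteq> QC \<and> (QE :: nat complex set) \<noteq> QC) \<and>
         (\<not> (QI :: nat complex set) \<subseteq> QE \<and> \<not> (QI :: nat complex set) \<subseteq> QC \<and>
          \<not> (QE :: nat complex set) \<subseteq> QI \<and> \<not> (QE :: nat complex set) \<subseteq> QC \<and>
          \<not> (QC :: nat complex set) \<subseteq> QI \<and> \<not> (QC :: nat complex set) \<subseteq> QE)"
  \<comment> \<open>Each witness refutes the two inclusions out of its class; the inequalities
    follow.\<close>
  using QI_only_witness QE_only_witness QC_only_witness by blast

end
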